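(* Let $X$ be a random variable with values in a set $\mathcal X$ with distribution $\mu$, and let $\mathcal F$ be a finite class of hypotheses $f:\mathcal X\to[0,1]$. For $\delta>0$ and $n\ge 2$ we have, with probability at least $1-\delta$ in $\mathbf X=(X_1,\dots,X_n)\sim\mu^n$, that $$P(f,\mu)-P_n(f,\mathbf X)\le \sqrt{\frac{2V_n(f,\mathbf X)\ln(2|\mathcal F|/\delta)}{n}}+\frac{7\ln(2|\mathcal F|/\delta)}{3(n-1)}\qquad\text{for all } f\in\mathcal F,$$ where $|\mathcal F|$ is the cardinality of $\mathcal F$.
   Context: $\mathbf X\sim\mu^n$ means that $X_1,\dots,X_n$ are i.i.d. with distribution $\mu$. For $f:\mathcal X\to[0,1]$ and $\mathbf x=(x_1,\dots,x_n)\in\mathcal X^n$: $P(f,\mu)=\mathbb E_{X\sim\mu}f(X)$; $P_n(f,\mathbf x)=\frac1n\sum_{i=1}^n f(x_i)$; $V_n(f,\mathbf x)=\frac{1}{n(n-1)}\sum_{1\le i<j\le n}(f(x_i)-f(x_j))^2$. All functions involved are assumed measurable. *)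

theory Defs
  imports "HOL-Probability.Probability"
begin

text \<open>The set in which the sample takes its values is \<open>space \<mu>\<close>. The measurability of each
  \<open>X i\<close> is part of \<open>indep_vars\<close>.\<close>

definition iid_sample :: "'w measure \<Rightarrow> 'a measure \<Rightarrow> nat \<Rightarrow> (nat \<Rightarrow> 'w \<Rightarrow> 'a) \<Rightarrow> bool" where
  "iid_sample \<Omega> \<mu> n X \<longleftrightarrow>
     prob_space.indep_vars \<Omega> (\<lambda>_. \<mu>) X {1..n} \<and> (\<forall>i\<in>{1..n}. distr \<Omega> \<mu> (X i) = \<mu>)"

definition pop_mean :: "('a \<Rightarrow> real) \<Rightarrow> 'a measure \<Rightarrow> real" where
  "pop_mean f \<mu> = (\<integral>x. f x \<partial>\<mu>)"

text \<open>A point \<open>(x\<^sub>1, \<dots>, x\<^sub>n)\<close> is a function on \<open>nat\<close>, of which only the values on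
  \<open>{1..n}\<close> are used.\<close>

definition emp_mean :: "nat \<Rightarrow> ('a \<Rightarrow> real) \<Rightarrow> (nat \<Rightarrow> 'a) \<Rightarrow> real" where
  "emp_mean n f x = 1 / real n * (\<Sum>i=1..n. f (x i))"

definition sample_var :: "nat \<Rightarrow> ('a \<Rightarrow> real) \<Rightarrow> (nat \<Rightarrow> 'a) \<Rightarrow> real" where
  "sample_var n f x =
     1 / (real n * (real n - 1)) * (\<Sum>i\<in>{1..n}. \<Sum>j\<in>{i<..n}. (f (x i) - f (x j))\<^sup>2)"

end

theory Submission
  imports Defs
begin

text \<open>For one function with variance \<open>v\<close> put \<open>L = ln (2 * card F / \<delta>)\<close>. Bernstein's
  inequality bounds the deviation of the empirical mean by
  \<open>sqrt (2 * v * L / n) + L / (3 * n)\<close>, and it remains to replace \<open>v\<close> by the sample variance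
  \<open>V\<close>. Here \<open>sqrt v \<le> sqrt V + sqrt (2 * L / (n - 1))\<close> holds outside an event of probability
  \<open>exp (- L)\<close>. Instead of the entropy method this uses Hoeffding's device for U-statistics:
  \<open>V\<close> is an average over the permutations of \<open>{1..n}\<close> of means of \<open>n div 2\<close> independent copies
  of \<open>h = (Y - Y')\<^sup>2 / 2\<close>, so by Jensen's inequality its moment generating function is bounded by
  that of such a mean. As \<open>0 \<le> h \<le> 1 / 2\<close> and \<open>h\<close> has expectation \<open>v\<close>, its second moment is
  at most \<open>v / 2\<close>, which together with \<open>n - 1 \<le> 2 * (n div 2)\<close> gives exactly the constant
  needed. A union bound over the two events and over \<open>F\<close> finishes the proof.\<close>

section \<open>Elementary bounds for the exponential function\<close>

text \<open>The difference of the two sides vanishes at \<open>l = 0\<close>. Its derivative in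
  \<open>l\<close> is \<open>z\<close> times a factor of the same weak sign: by convexity of
  \<open>exp\<close> for \<open>z \<ge> 0\<close>, by \<open>1 + x \<le> exp x\<close> for
  \<open>z < 0\<close>. Being quadratic in \<open>z\<close>, the bound lets a variance control an
  exponential moment.\<close>

lemma exp_le_bennett:
  fixes l z :: real
  assumes "0 \<le> l" "\<bar>z\<bar> \<le> 1"
  shows "exp (l * z) \<le> 1 + l * z + z\<^sup>2 * (exp l - 1 - l)"
proof -
  define g where "g = (\<lambda>l. z\<^sup>2 * (exp l - 1 - l) - (exp (l * z) - 1 - l * z))"
  have "g 0 \<le> g l"
  proof (rule DERIV_nonneg_imp_nondecreasing[OF assms(1)])
    fix x :: real assume "0 \<le> x"
    have "(g has_real_derivative z * (z * (exp x - 1) - (exp (x * z) - 1))) (at x)"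
      unfolding g_def by (auto intro!: derivative_eq_intros simp: algebra_simps power2_eq_square)
    moreover have "z * (z * (exp x - 1) - (exp (x * z) - 1)) \<ge> 0"
    proof (cases "z \<ge> 0")
      case True
      have "exp (x * z) \<le> (1 - z) * exp 0 + z * exp x"
        using convex_onD[OF exp_convex, of z 0 x] True assms(2) by (simp add: mult.commute)
      then show ?thesis
        using True by (intro mult_nonneg_nonneg) (auto simp: algebra_simps)
    next
      case False
      have "z * (exp x - 1) \<le> z * x"
        using False exp_ge_add_one_self[of x] by (intro mult_left_mono_neg) linarith+
      also have "\<dots> \<le> exp (x * z) - 1"
        using exp_ge_add_one_self[of "x * z"] unfolding mult.commute[of z x] by linarith
      finally show ?thesis
        using False by (simp add: mult_nonpos_nonpos)
    qed
    ultimately show "\<exists>y. (g has_real_derivative y) (at x) \<and> 0 \<le> y" by blast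
  qed
  then show ?thesis by (simp add: g_def)
qed

text \<open>For \<open>l < 3\<close> the denominator is positive and can be cleared. The resulting
  difference \<open>g\<close> and its derivative \<open>g'\<close> both vanish at \<open>0\<close>,
  and \<open>g'\<close> is nondecreasing because \<open>1 - x \<le> exp (- x)\<close>.\<close>

lemma exp_remainder_le_bernstein:
  fixes l :: real
  assumes "0 \<le> l" "l < 3"
  shows "exp l - 1 - l \<le> l\<^sup>2 / (2 * (1 - l / 3))"
proof -
  define g' :: "real \<Rightarrow> real" where "g' = (\<lambda>x. 4 + 2 * x - 4 * exp x + 2 * x * exp x)"
  define g :: "real \<Rightarrow> real" where "g = (\<lambda>x. 3 * x\<^sup>2 - (6 - 2 * x) * (exp x - 1 - x))"
  have g': "0 \<le> g' x" if "0 \<le> x" for x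
  proof -
    have "g' 0 \<le> g' x"
    proof (rule DERIV_nonneg_imp_nondecreasing[OF that])
      fix x :: real
      have "(g' has_real_derivative 2 * (1 - exp x * (1 - x))) (at x)"
        unfolding g'_def by (auto intro!: derivative_eq_intros simp: algebra_simps)
      moreover have "exp x * (1 - x) \<le> exp x * exp (- x)"
        using exp_ge_add_one_self[of "- x"] by (intro mult_left_mono) auto
      ultimately show "\<exists>y. (g' has_real_derivative y) (at x) \<and> 0 \<le> y"
        by (auto simp flip: exp_add)
    qed
    then show ?thesis by (simp add: g'_def)
  qed
  have "g 0 \<le> g l"
  proof (rule DERIV_nonneg_imp_nondecreasing[OF assms(1)])
    fix x :: real assume "0 \<le> x"
    moreover have "(g has_real_derivative g' x) (at x)"
      unfolding g_def g'_def by (auto intro!: derivative_eq_intros simp: algebra_simps)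
    ultimately show "\<exists>y. (g has_real_derivative y) (at x) \<and> 0 \<le> y"
      using g' by blast
  qed
  then have "(6 - 2 * l) * (exp l - 1 - l) \<le> 3 * l\<^sup>2"
    by (simp add: g_def)
  then show ?thesis
    using assms by (simp add: field_simps)
qed

lemma exp_minus_le_quadratic:
  fixes x :: real
  assumes "0 \<le> x"
  shows "exp (- x) \<le> 1 - x + x\<^sup>2 / 2"
proof -
  define g :: "real \<Rightarrow> real" where "g = (\<lambda>x. 1 - x + x\<^sup>2 / 2 - exp (- x))"
  have "g 0 \<le> g x"
  proof (rule DERIV_nonneg_imp_nondecreasing[OF assms])
    fix x :: real
    have "(g has_real_derivative - 1 + x + exp (- x)) (at x)"
      unfolding g_def by (auto intro!: derivative_eq_intros)
    then show "\<exists>y. (g has_real_derivative y) (at x) \<and> 0 \<le> y"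
      using exp_ge_add_one_self[of "- x"] by (intro exI conjI) auto
  qed
  then show ?thesis by (simp add: g_def)
qed

section \<open>The sample variance as an average over permutations\<close>

text \<open>Composing on the right with a permutation that sends \<open>c\<close> to
  \<open>a\<close> and \<open>d\<close> to \<open>b\<close> only reindexes the sum.\<close>

lemma sum_permutes_pair:
  fixes g :: "'a \<Rightarrow> 'a \<Rightarrow> real"
  assumes "finite A" "a \<in> A" "b \<in> A" "c \<in> A" "d \<in> A" "a \<noteq> b" "c \<noteq> d"
  shows "(\<Sum>\<pi> | \<pi> permutes A. g (\<pi> a) (\<pi> b)) = (\<Sum>\<pi> | \<pi> permutes A. g (\<pi> c) (\<pi> d))"
proof -
  \<comment> \<open>The inner transposition sends \<open>c\<close> to \<open>a\<close> and may move
    \<open>d\<close>. The outer one takes the image of \<open>d\<close> to \<open>b\<close> and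
    fixes \<open>a\<close>, which differs from \<open>b\<close> and from that image.\<close>
  define q where "q = Transposition.transpose (Transposition.transpose c a d) b \<circ> Transposition.transpose c a"
  have "Transposition.transpose c a d \<in> A"
    using assms by (auto simp: Transposition.transpose_def)
  then have q: "q permutes A"
    unfolding q_def using assms by (intro permutes_compose permutes_swap_id) auto
  have "q c = a" "q d = b"
    using assms by (auto simp: q_def Transposition.transpose_def)
  then show ?thesis
    using sum_permutations_compose_right[OF q, of "\<lambda>\<pi>. g (\<pi> a) (\<pi> b)"]
      sum_permutations_compose_right[OF q, of "\<lambda>\<pi>. g (\<pi> c) (\<pi> d)"] by simp
qed

text \<open>The double sum is unchanged when its indices are relabelled by a permutation, so it can
  be averaged over all of them. After exchanging sums the diagonal contributes nothing, and all
  ordered pairs of distinct indices contribute the same amount.\<close>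

lemma sum_off_diagonal_permutes:
  fixes g :: "'a \<Rightarrow> 'a \<Rightarrow> real"
  assumes "finite A" "\<And>i. i \<in> A \<Longrightarrow> g i i = 0" "c \<in> A" "d \<in> A" "c \<noteq> d"
  shows "fact (card A) * (\<Sum>i\<in>A. \<Sum>j\<in>A. g i j)
    = real (card A) * (real (card A) - 1) * (\<Sum>\<pi> | \<pi> permutes A. g (\<pi> c) (\<pi> d))"
proof -
  let ?P = "{\<pi>. \<pi> permutes A}" and ?S = "\<Sum>\<pi> | \<pi> permutes A. g (\<pi> c) (\<pi> d)"
  have "fact (card A) * (\<Sum>i\<in>A. \<Sum>j\<in>A. g i j) = (\<Sum>\<pi>\<in>?P. \<Sum>i\<in>A. \<Sum>j\<in>A. g i j)"
    using card_permutations[OF refl assms(1)] by simp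
  also have "\<dots> = (\<Sum>\<pi>\<in>?P. \<Sum>i\<in>A. \<Sum>j\<in>A. g (\<pi> i) (\<pi> j))"
  proof (rule sum.cong[OF refl])
    fix \<pi> assume "\<pi> \<in> ?P"
    then have bij: "bij_betw \<pi> A A"
      by (simp add: permutes_imp_bij)
    show "(\<Sum>i\<in>A. \<Sum>j\<in>A. g i j) = (\<Sum>i\<in>A. \<Sum>j\<in>A. g (\<pi> i) (\<pi> j))"
      unfolding sum.reindex_bij_betw[OF bij, of "g _"]
      by (rule sum.reindex_bij_betw[OF bij, symmetric])
  qed
  also have "\<dots> = (\<Sum>i\<in>A. \<Sum>j\<in>A. \<Sum>\<pi>\<in>?P. g (\<pi> i) (\<pi> j))"
    by (subst sum.swap, intro sum.cong refl, rule sum.swap)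
  also have "\<dots> = (\<Sum>i\<in>A. \<Sum>j\<in>A. if j = i then 0 else ?S)"
  proof (intro sum.cong refl)
    fix i j assume "i \<in> A" "j \<in> A"
    then show "(\<Sum>\<pi>\<in>?P. g (\<pi> i) (\<pi> j)) = (if j = i then 0 else ?S)"
      using sum_permutes_pair[of A i j c d g] assms
      by (auto intro!: sum.neutral simp: permutes_in_image)
  qed
  also have "\<dots> = (\<Sum>i\<in>A. (real (card A) - 1) * ?S)"
  proof (intro sum.cong refl)
    fix i assume i: "i \<in> A"
    then have "card A \<ge> 1"
      using assms(1) card_gt_0_iff[of A] by auto
    have "(\<Sum>j\<in>A. if j = i then 0 else ?S) = (\<Sum>j\<in>A - {i}. ?S)"
      using assms(1) by (intro sum.mono_neutral_cong_right) auto
    then show "(\<Sum>j\<in>A. if j = i then 0 else ?S) = (real (card A) - 1) * ?S"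
      using i \<open>card A \<ge> 1\<close> assms(1) by (simp add: card_Diff_singleton of_nat_diff)
  qed
  finally show ?thesis by simp
qed

lemma sum_upper_triangle:
  fixes g :: "nat \<Rightarrow> nat \<Rightarrow> real"
  assumes "\<And>i j. g i j = g j i" "\<And>i. g i i = 0"
  shows "2 * (\<Sum>i\<in>{1..n}. \<Sum>j\<in>{i<..n}. g i j) = (\<Sum>i\<in>{1..n}. \<Sum>j\<in>{1..n}. g i j)"
proof (induction n)
  case (Suc n)
  have "(\<Sum>i\<in>{1..Suc n}. \<Sum>j\<in>{i<..Suc n}. g i j) = (\<Sum>i\<in>{1..n}. \<Sum>j\<in>{i<..Suc n}. g i j)"
    by simp
  also have "\<dots> = (\<Sum>i\<in>{1..n}. (\<Sum>j\<in>{i<..n}. g i j) + g i (Suc n))"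
  proof (intro sum.cong refl)
    fix i assume "i \<in> {1..n}"
    then have "{i<..Suc n} = insert (Suc n) {i<..n}" by auto
    then show "(\<Sum>j\<in>{i<..Suc n}. g i j) = (\<Sum>j\<in>{i<..n}. g i j) + g i (Suc n)" by simp
  qed
  finally show ?case
    using Suc assms by (simp add: sum.distrib)
qed simp

text \<open>The point of this representation is that the pairs \<open>{\<pi> k, \<pi> (k + m)}\<close>, \<open>k \<in> {1..m}\<close>, are
  disjoint for each fixed \<open>\<pi>\<close>.\<close>

lemma sample_var_eq_permutation_average:
  assumes n: "n \<ge> 2" and m: "m = n div 2"
  shows "sample_var n f x = (\<Sum>\<pi> | \<pi> permutes {1..n}.
    1 / fact n * (1 / real m * (\<Sum>k\<in>{1..m}. (f (x (\<pi> k)) - f (x (\<pi> (k + m))))\<^sup>2 / 2)))"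
proof -
  let ?P = "{\<pi>. \<pi> permutes {1..n}}"
  let ?g = "\<lambda>i j. (f (x i) - f (x j))\<^sup>2"
  have *: "fact n * (2 * (\<Sum>i\<in>{1..n}. \<Sum>j\<in>{i<..n}. ?g i j))
      = real n * (real n - 1) * (\<Sum>\<pi>\<in>?P. ?g (\<pi> k) (\<pi> (k + m)))"
    if "k \<in> {1..m}" for k
  proof -
    have "2 * (\<Sum>i\<in>{1..n}. \<Sum>j\<in>{i<..n}. ?g i j) = (\<Sum>i\<in>{1..n}. \<Sum>j\<in>{1..n}. ?g i j)"
      by (intro sum_upper_triangle) (auto simp: power2_commute)
    \<comment> \<open>As \<open>m = n div 2\<close>, both positions lie in \<open>{1..n}\<close>;
      for odd \<open>n\<close> the position \<open>n\<close> stays unpaired.\<close>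
    moreover have "k \<in> {1..n}" "k + m \<in> {1..n}" "k \<noteq> k + m"
      using that m by auto
    ultimately show ?thesis
      using sum_off_diagonal_permutes[of "{1..n}" ?g k "k + m"] by simp
  qed
  have *: "(\<Sum>\<pi>\<in>?P. ?g (\<pi> k) (\<pi> (k + m))) = 2 * fact n * sample_var n f x"
    if "k \<in> {1..m}" for k
    using *[OF that] n by (simp add: sample_var_def divide_simps mult_ac)
  have "(\<Sum>\<pi>\<in>?P. 1 / fact n * (1 / real m * (\<Sum>k\<in>{1..m}. ?g (\<pi> k) (\<pi> (k + m)) / 2)))
      = 1 / fact n * (1 / real m * (\<Sum>k\<in>{1..m}. (\<Sum>\<pi>\<in>?P. ?g (\<pi> k) (\<pi> (k + m))) / 2))"
    by (simp add: sum_distrib_left sum_divide_distrib) (rule sum.swap)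
  also have "\<dots> = 1 / fact n * (1 / real m * (\<Sum>k\<in>{1..m}. fact n * sample_var n f x))"
    using * by simp
  also have "\<dots> = sample_var n f x"
    using n m by simp
  finally show ?thesis by simp
qed

lemma sample_var_nonneg: "n \<ge> 2 \<Longrightarrow> 0 \<le> sample_var n f x"
  unfolding sample_var_def by (intro mult_nonneg_nonneg sum_nonneg) auto

section \<open>Bernstein's inequality for a single function\<close>

lemma (in prob_space) chernoff_bound:
  fixes f :: "'a \<Rightarrow> real"
  assumes "s > 0" "integrable M (\<lambda>x. exp (s * f x))" "expectation (\<lambda>x. exp (s * f x)) \<le> exp K"
  shows "prob {x \<in> space M. f x \<ge> t} \<le> exp (K - s * t)"
proof -
  have "prob {x \<in> space M. f x \<ge> t} \<le> exp (- s * t) * (LINT x:space M|M. exp (s * f x))"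
    using assms by (intro Chernoff_ineq_ge) (auto simp only: set_integrable_def intro!: integrable_mult_indicator)
  also have "(LINT x:space M|M. exp (s * f x)) = expectation (\<lambda>x. exp (s * f x))"
    by (intro set_integral_space assms)
  also have "exp (- s * t) * \<dots> \<le> exp (- s * t) * exp K"
    using assms by (intro mult_left_mono) auto
  finally show ?thesis by (simp flip: exp_add)
qed

text \<open>This isolates one hypothesis: \<open>Y i\<close> will be \<open>f\<close> applied to
  \<open>X i\<close>. Common mean and common variance stand in for identical distribution.\<close>

locale iid_unit_interval = prob_space M for M :: "'w measure" +
  fixes n :: nat and Y :: "nat \<Rightarrow> 'w \<Rightarrow> real" and p v :: real
  assumes indep: "indep_vars (\<lambda>_. borel) Y {1..n}"
    and unit: "\<And>i \<omega>. i \<in> {1..n} \<Longrightarrow> \<omega> \<in> space M \<Longrightarrow> Y i \<omega> \<in> {0..1}"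
    and mean: "\<And>i. i \<in> {1..n} \<Longrightarrow> expectation (Y i) = p"
    and var: "\<And>i. i \<in> {1..n} \<Longrightarrow> expectation (\<lambda>\<omega>. (Y i \<omega> - p)\<^sup>2) = v"
    and n_ge_2: "n \<ge> 2"
begin

lemma measurable_Y [measurable]: "i \<in> {1..n} \<Longrightarrow> Y i \<in> borel_measurable M"
  using indep by (auto simp: indep_vars_def)

lemma measurable_sample_var [measurable]:
  "(\<lambda>\<omega>. sample_var n (\<lambda>y. y) (\<lambda>i. Y i \<omega>)) \<in> borel_measurable M"
  unfolding sample_var_def by measurable

lemma measurable_emp_mean [measurable]:
  "(\<lambda>\<omega>. emp_mean n (\<lambda>y. y) (\<lambda>i. Y i \<omega>)) \<in> borel_measurable M"
  unfolding emp_mean_def by measurable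

lemma integrable_Y: "i \<in> {1..n} \<Longrightarrow> integrable M (Y i)"
  using unit[of i] by (intro integrable_const_bound[where B = 1]) (auto intro!: AE_I2)

lemma p_unit: "p \<in> {0..1}"
proof -
  have "1 \<in> {1..n}" using n_ge_2 by simp
  then show ?thesis
    using integral_ge_const[OF integrable_Y, of 1 0] integral_le_const[OF integrable_Y, of 1 1]
      mean[of 1] unit[of 1] by (auto intro: AE_I2)
qed

lemma abs_centered_le: "i \<in> {1..n} \<Longrightarrow> \<omega> \<in> space M \<Longrightarrow> \<bar>p - Y i \<omega>\<bar> \<le> 1"
  using unit[of i \<omega>] p_unit by auto

lemma integrable_centered:
  assumes "i \<in> {1..n}"
  shows "integrable M (\<lambda>\<omega>. p - Y i \<omega>)" "integrable M (\<lambda>\<omega>. (p - Y i \<omega>)\<^sup>2)"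
    "integrable M (\<lambda>\<omega>. exp (l * (p - Y i \<omega>)))"
proof -
  show "integrable M (\<lambda>\<omega>. p - Y i \<omega>)"
    using integrable_Y[OF assms] by simp
  show "integrable M (\<lambda>\<omega>. (p - Y i \<omega>)\<^sup>2)"
    using assms abs_centered_le[OF assms]
    by (intro integrable_const_bound[where B = 1]) (auto intro!: AE_I2 simp: abs_square_le_1)
  have "\<bar>l * (p - Y i \<omega>)\<bar> \<le> \<bar>l\<bar> * 1" if "\<omega> \<in> space M" for \<omega>
    unfolding abs_mult using abs_centered_le[OF assms that] by (intro mult_left_mono) auto
  then show "integrable M (\<lambda>\<omega>. exp (l * (p - Y i \<omega>)))"
    using assms by (intro integrable_const_bound[where B = "exp \<bar>l\<bar>"]) (auto intro!: AE_I2 dest: abs_le_D1)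
qed

lemma expectation_centered:
  assumes "i \<in> {1..n}"
  shows "expectation (\<lambda>\<omega>. p - Y i \<omega>) = 0" "expectation (\<lambda>\<omega>. (p - Y i \<omega>)\<^sup>2) = v"
  using assms mean[OF assms] var[OF assms] integrable_Y[OF assms]
  by (simp_all add: power2_commute prob_space)

lemma v_nonneg: "0 \<le> v"
proof -
  have "0 \<le> expectation (\<lambda>\<omega>. (Y 1 \<omega> - p)\<^sup>2)"
    by (rule Bochner_Integration.integral_nonneg) simp
  also have "\<dots> = v"
    using n_ge_2 by (intro var) auto
  finally show ?thesis .
qed

text \<open>Apply \<open>exp_le_bennett\<close> pointwise with \<open>z = p - Y i\<close>. In
  expectation the linear term vanishes and the square becomes \<open>v\<close>;
  \<open>1 + x \<le> exp x\<close> then gives a form that multiplies well over independent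
  factors.\<close>

lemma mgf_centered:
  assumes "i \<in> {1..n}" "0 \<le> l"
  shows "expectation (\<lambda>\<omega>. exp (l * (p - Y i \<omega>))) \<le> exp (v * (exp l - 1 - l))"
proof -
  note [simp] = integrable_centered[OF assms(1)] expectation_centered[OF assms(1)]
  have "expectation (\<lambda>\<omega>. exp (l * (p - Y i \<omega>)))
      \<le> expectation (\<lambda>\<omega>. 1 + l * (p - Y i \<omega>) + (p - Y i \<omega>)\<^sup>2 * (exp l - 1 - l))"
    using exp_le_bennett[OF assms(2)] abs_centered_le[OF assms(1)]
    by (intro integral_mono Bochner_Integration.integrable_add integrable_mult_left
        integrable_mult_right) auto
  also have "\<dots> = expectation (\<lambda>\<omega>. 1 + l * (p - Y i \<omega>))
      + expectation (\<lambda>\<omega>. (p - Y i \<omega>)\<^sup>2 * (exp l - 1 - l))"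
    by (intro Bochner_Integration.integral_add Bochner_Integration.integrable_add
        integrable_mult_left integrable_mult_right) auto
  also have "expectation (\<lambda>\<omega>. 1 + l * (p - Y i \<omega>)) = 1 + expectation (\<lambda>\<omega>. l * (p - Y i \<omega>))"
    by (subst Bochner_Integration.integral_add) (auto simp: prob_space intro!: integrable_mult_right)
  also have "expectation (\<lambda>\<omega>. l * (p - Y i \<omega>)) = 0"
    by (subst integral_mult_right_zero) auto
  also have "expectation (\<lambda>\<omega>. (p - Y i \<omega>)\<^sup>2 * (exp l - 1 - l)) = v * (exp l - 1 - l)"
    by (subst integral_mult_left_zero) auto
  also have "1 + 0 + v * (exp l - 1 - l) \<le> exp (v * (exp l - 1 - l))"
    using exp_ge_add_one_self by simp
  finally show ?thesis .
qed

lemma chernoff_sum_centered: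
  assumes "0 < l"
  shows "prob {\<omega> \<in> space M. (\<Sum>i=1..n. p - Y i \<omega>) \<ge> t}
    \<le> exp (real n * v * (exp l - 1 - l) - l * t)"
proof (rule chernoff_bound[OF assms])
  have eq: "exp (l * (\<Sum>i=1..n. p - Y i \<omega>)) = (\<Prod>i\<in>{1..n}. exp (l * (p - Y i \<omega>)))" for \<omega>
    by (simp add: sum_distrib_left exp_sum)
  have ind: "indep_vars (\<lambda>_. borel) (\<lambda>i \<omega>. exp (l * (p - Y i \<omega>))) {1..n}"
    by (rule indep_vars_compose2[OF indep]) auto
  show "integrable M (\<lambda>\<omega>. exp (l * (\<Sum>i=1..n. p - Y i \<omega>)))"
    unfolding eq by (intro indep_vars_integrable ind integrable_centered) auto
  have "expectation (\<lambda>\<omega>. exp (l * (\<Sum>i=1..n. p - Y i \<omega>)))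
      = (\<Prod>i\<in>{1..n}. expectation (\<lambda>\<omega>. exp (l * (p - Y i \<omega>))))"
    unfolding eq by (intro indep_vars_lebesgue_integral ind integrable_centered) auto
  also have "\<dots> \<le> (\<Prod>i\<in>{1..n}. exp (v * (exp l - 1 - l)))"
    using assms mgf_centered by (intro prod_mono) auto
  also have "\<dots> = exp (real n * v * (exp l - 1 - l))"
    by (simp flip: exp_of_nat_mult add: mult.assoc)
  finally show "expectation (\<lambda>\<omega>. exp (l * (\<Sum>i=1..n. p - Y i \<omega>)))
      \<le> exp (real n * v * (exp l - 1 - l))" .
qed

text \<open>For positive variance, replacing \<open>exp l - 1 - l\<close> by its rational majorant
  makes the Chernoff exponent optimisable in closed form, and the threshold is the one that makes it
  \<open>- L\<close>.\<close>

lemma bernstein: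
  assumes "0 < L"
  shows "prob {\<omega> \<in> space M. p - emp_mean n (\<lambda>y. y) (\<lambda>i. Y i \<omega>) \<ge> sqrt (2 * v * L / n) + L / (3 * n)}
    \<le> exp (- L)"
proof -
  define w where "w = real n * v"
  define t where "t = sqrt (2 * w * L) + L / 3"
  have n: "real n > 0" using n_ge_2 by simp
  have "(sqrt (2 * v * L / n) + L / (3 * n)) * n = t"
  proof -
    have "sqrt (2 * v * L / n) * n = sqrt (2 * v * L / n) * sqrt (n * n)"
      by simp
    also have "\<dots> = sqrt (2 * w * L)"
      unfolding real_sqrt_mult[symmetric] w_def using n by (simp add: field_simps)
    finally show ?thesis
      using n by (simp add: t_def distrib_right)
  qed
  then have "p - emp_mean n (\<lambda>y. y) y \<ge> sqrt (2 * v * L / n) + L / (3 * n)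
      \<longleftrightarrow> (\<Sum>i=1..n. p - y i) \<ge> t" for y
    using n by (simp add: emp_mean_def sum_subtractf field_simps)
  then have "prob {\<omega> \<in> space M. p - emp_mean n (\<lambda>y. y) (\<lambda>i. Y i \<omega>) \<ge> sqrt (2 * v * L / n) + L / (3 * n)}
      = prob {\<omega> \<in> space M. (\<Sum>i=1..n. p - Y i \<omega>) \<ge> t}"
    by simp
  also have "\<dots> \<le> exp (- L)"
  proof (cases "w = 0")
    case True
    \<comment> \<open>Without variance the optimal \<open>l\<close> of the other case would divide
      by zero. Now \<open>t = L / 3\<close>, and \<open>l = 3\<close> gives the exponent
      \<open>- 3 * t = - L\<close>.\<close>
    show ?thesis
      using chernoff_sum_centered[of 3 t] unfolding w_def[symmetric] True t_def by simp
  next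
    case False
    then have w: "w > 0" using v_nonneg n by (simp add: w_def)
    \<comment> \<open>\<open>l\<close> minimises \<open>(L + w * l\<^sup>2 / (2 * (1 - l / 3))) / l\<close>, with minimal value \<open>t\<close>.\<close>
    define r where "r = sqrt (2 * L / w)"
    define l where "l = r / (1 + r / 3)"
    have r: "r > 0" using w assms by (simp add: r_def)
    then have l: "l > 0" "l < 3" and u: "1 - l / 3 = 1 / (1 + r / 3)"
      by (auto simp: l_def field_simps)
    have "r\<^sup>2 * w = 2 * L"
      using w assms by (simp add: r_def)
    moreover have "sqrt (2 * w * L) = r * w"
    proof (rule real_sqrt_unique)
      show "(r * w)\<^sup>2 = 2 * w * L"
        using \<open>r\<^sup>2 * w = 2 * L\<close> by (simp add: power2_eq_square algebra_simps)
    qed (use r w in auto)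
    \<comment> \<open>Expressing \<open>t\<close> and \<open>L\<close> as polynomials in
      \<open>r\<close> and \<open>w\<close> removes all square roots from the exponent.\<close>
    ultimately have t: "t = r * w + r\<^sup>2 * w / 6" and L: "L = r\<^sup>2 * w / 2"
      by (simp_all add: t_def)
    have "w * (exp l - 1 - l) - l * t \<le> w * (l\<^sup>2 / (2 * (1 - l / 3))) - l * t"
      using w l exp_remainder_le_bernstein[of l]
      by (intro diff_right_mono mult_left_mono) auto
    also have "\<dots> = - L"
    proof -
      define q where "q = 1 + r / 3"
      have q: "q > 0" using r by (simp add: q_def)
      then have "w * ((r / q)\<^sup>2 / (2 * (1 / q))) - r / q * (r * w + r\<^sup>2 * w / 6)
          = - (r\<^sup>2 * w / 2) * ((1 + r / 3) / q)"
        by (simp add: field_simps power2_eq_square)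
      also have "(1 + r / 3) / q = 1"
        using q by (simp add: q_def)
      finally show ?thesis
        unfolding u t L unfolding l_def q_def by simp
    qed
    finally show ?thesis
      using chernoff_sum_centered[OF l(1), of t] unfolding w_def[symmetric]
      by (rule_tac order_trans) auto
  qed
  finally show ?thesis .
qed

section \<open>Lower tail of the sample variance\<close>

text \<open>Expand the square around \<open>p\<close>: independence kills the cross term and two
  variances remain. The cross term is written as a product over \<open>{i, j}\<close> to match the
  product rule for independent families.\<close>

lemma expectation_pair:
  assumes "i \<in> {1..n}" "j \<in> {1..n}" "i \<noteq> j"
  shows "integrable M (\<lambda>\<omega>. (Y i \<omega> - Y j \<omega>)\<^sup>2)"
    "expectation (\<lambda>\<omega>. (Y i \<omega> - Y j \<omega>)\<^sup>2) = 2 * v"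
proof -
  have ind: "indep_vars (\<lambda>_. borel) (\<lambda>i \<omega>. p - Y i \<omega>) {i, j}"
    using assms by (intro indep_vars_compose2[OF indep_vars_subset[OF indep]]) auto
  have eq: "(Y i \<omega> - Y j \<omega>)\<^sup>2
      = (p - Y i \<omega>)\<^sup>2 + (p - Y j \<omega>)\<^sup>2 - 2 * (\<Prod>k\<in>{i, j}. p - Y k \<omega>)" for \<omega>
    using assms by (simp add: power2_eq_square algebra_simps)
  have int: "integrable M (\<lambda>\<omega>. \<Prod>k\<in>{i, j}. p - Y k \<omega>)"
    using assms by (intro indep_vars_integrable ind integrable_centered) auto
  have prod: "expectation (\<lambda>\<omega>. \<Prod>k\<in>{i, j}. p - Y k \<omega>) = 0"
    using assms expectation_centered
    by (subst indep_vars_lebesgue_integral[OF _ ind]) (auto intro!: integrable_centered)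
  show "integrable M (\<lambda>\<omega>. (Y i \<omega> - Y j \<omega>)\<^sup>2)"
    unfolding eq using assms integrable_centered int
    by (intro Bochner_Integration.integrable_diff Bochner_Integration.integrable_add integrable_mult_right) auto
  show "expectation (\<lambda>\<omega>. (Y i \<omega> - Y j \<omega>)\<^sup>2) = 2 * v"
    unfolding eq using assms integrable_centered(2) int prod expectation_centered(2)
    by (simp del: prod.insert)
qed

lemma mgf_pair:
  assumes "i \<in> {1..n}" "j \<in> {1..n}" "i \<noteq> j" "0 \<le> s"
  shows "integrable M (\<lambda>\<omega>. exp (s * (v - (Y i \<omega> - Y j \<omega>)\<^sup>2 / 2)))"
    "expectation (\<lambda>\<omega>. exp (s * (v - (Y i \<omega> - Y j \<omega>)\<^sup>2 / 2))) \<le> exp (s\<^sup>2 * v / 4)"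
proof -
  define h where "h = (\<lambda>\<omega>. (Y i \<omega> - Y j \<omega>)\<^sup>2 / 2)"
  have h: "0 \<le> h \<omega>" "h \<omega> \<le> 1 / 2" if "\<omega> \<in> space M" for \<omega>
    using unit[OF assms(1) that] unit[OF assms(2) that]
    by (auto simp: h_def abs_square_le_1)
  have [measurable]: "h \<in> borel_measurable M"
    unfolding h_def using assms by measurable
  have int: "integrable M h" and exph: "expectation h = v"
    using expectation_pair[OF assms(1-3)] by (simp_all add: h_def)
  have int_exp: "integrable M (\<lambda>\<omega>. exp (- (s * h \<omega>)))"
    using assms h by (intro integrable_const_bound[where B = 1]) (auto intro!: AE_I2)
  have eq: "exp (s * (v - (Y i \<omega> - Y j \<omega>)\<^sup>2 / 2)) = exp (s * v) * exp (- (s * h \<omega>))" for \<omega>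
    by (simp add: h_def right_diff_distrib flip: exp_add)
  show "integrable M (\<lambda>\<omega>. exp (s * (v - (Y i \<omega> - Y j \<omega>)\<^sup>2 / 2)))"
    unfolding eq using int_exp by simp
  have "expectation (\<lambda>\<omega>. exp (- (s * h \<omega>))) \<le> expectation (\<lambda>\<omega>. 1 + (s\<^sup>2 / 4 - s) * h \<omega>)"
  proof (intro integral_mono int_exp)
    fix \<omega> assume \<omega>: "\<omega> \<in> space M"
    have "exp (- (s * h \<omega>)) \<le> 1 - s * h \<omega> + (s * h \<omega>)\<^sup>2 / 2"
      using assms h[OF \<omega>] by (intro exp_minus_le_quadratic) simp
    \<comment> \<open>The bound \<open>h \<le> 1 / 2\<close> makes the quadratic term linear in
      \<open>h\<close>, so that the expectation of \<open>h\<close>, which is \<open>v\<close>, is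
      all that enters.\<close>
    also have "(s * h \<omega>)\<^sup>2 \<le> s\<^sup>2 * (h \<omega> * (1 / 2))"
      unfolding power_mult_distrib power2_eq_square[of "h \<omega>"]
      using h[OF \<omega>] by (intro mult_left_mono) auto
    finally show "exp (- (s * h \<omega>)) \<le> 1 + (s\<^sup>2 / 4 - s) * h \<omega>"
      by (simp add: algebra_simps)
  qed (use int in simp)
  also have "\<dots> = 1 + (s\<^sup>2 / 4 - s) * v"
    using int exph by (simp add: prob_space)
  also have "\<dots> \<le> exp ((s\<^sup>2 / 4 - s) * v)"
    by (rule exp_ge_add_one_self)
  finally have "exp (s * v) * expectation (\<lambda>\<omega>. exp (- (s * h \<omega>)))
      \<le> exp (s * v) * exp ((s\<^sup>2 / 4 - s) * v)"
    by (intro mult_left_mono) auto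
  also have "\<dots> = exp (s\<^sup>2 * v / 4)"
    by (simp add: algebra_simps flip: exp_add)
  finally show "expectation (\<lambda>\<omega>. exp (s * (v - (Y i \<omega> - Y j \<omega>)\<^sup>2 / 2))) \<le> exp (s\<^sup>2 * v / 4)"
    unfolding eq by simp
qed

text \<open>For fixed \<open>\<pi>\<close> no index occurs in two pairs, so the summands of
  \<open>W\<close> are independent and the bound of \<open>mgf_pair\<close> is raised to the power
  \<open>m\<close>.\<close>

lemma mgf_disjoint_pairs:
  assumes m: "m = n div 2" and \<pi>: "\<pi> permutes {1..n}" and s: "0 \<le> s"
  defines "W \<equiv> \<lambda>\<omega>. \<Sum>k\<in>{1..m}. v - (Y (\<pi> k) \<omega> - Y (\<pi> (k + m)) \<omega>)\<^sup>2 / 2"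
  shows "integrable M (\<lambda>\<omega>. exp (s * W \<omega>))"
    "expectation (\<lambda>\<omega>. exp (s * W \<omega>)) \<le> exp (real m * s\<^sup>2 * v / 4)"
proof -
  define h where "h = (\<lambda>k \<omega>. exp (s * (v - (Y (\<pi> k) \<omega> - Y (\<pi> (k + m)) \<omega>)\<^sup>2 / 2)))"
  have inj: "\<pi> a = \<pi> b \<longleftrightarrow> a = b" for a b
    using permutes_inj[OF \<pi>] by (auto dest: injD)
  have in_I: "\<pi> k \<in> {1..n}" "\<pi> (k + m) \<in> {1..n}" if "k \<in> {1..m}" for k
    unfolding permutes_in_image[OF \<pi>] using that m by auto
  have neq: "\<pi> k \<noteq> \<pi> (k + m)" if "k \<in> {1..m}" for k
    using that inj by auto
  let ?K = "\<lambda>k. {\<pi> k, \<pi> (k + m)}"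
  have "disjoint_family_on ?K {1..m}"
    by (auto simp: disjoint_family_on_def inj)
  \<comment> \<open>Grouping independent variables into disjoint blocks gives independent vectors;
    each factor \<open>h k\<close> is then a measurable function of its own block.\<close>
  then have "indep_vars (\<lambda>k. PiM (?K k) (\<lambda>_. borel)) (\<lambda>k \<omega>. restrict (\<lambda>i. Y i \<omega>) (?K k)) {1..m}"
    using in_I by (intro indep_vars_restrict[OF indep]) auto
  then have "indep_vars (\<lambda>_. borel) (\<lambda>k \<omega>. (\<lambda>y. exp (s * (v - (y (\<pi> k) - y (\<pi> (k + m)))\<^sup>2 / 2)))
      (restrict (\<lambda>i. Y i \<omega>) (?K k))) {1..m}"
    by (rule indep_vars_compose2) measurable
  then have ind: "indep_vars (\<lambda>_. borel) h {1..m}"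
    by (simp add: h_def)
  have int: "integrable M (h k)" if "k \<in> {1..m}" for k
    unfolding h_def using mgf_pair(1)[OF in_I[OF that] neq[OF that] s] .
  have eq: "exp (s * W \<omega>) = (\<Prod>k\<in>{1..m}. h k \<omega>)" for \<omega>
    by (simp add: W_def h_def sum_distrib_left exp_sum)
  show "integrable M (\<lambda>\<omega>. exp (s * W \<omega>))"
    unfolding eq by (intro indep_vars_integrable ind int) auto
  have "expectation (\<lambda>\<omega>. exp (s * W \<omega>)) = (\<Prod>k\<in>{1..m}. expectation (h k))"
    unfolding eq by (intro indep_vars_lebesgue_integral ind int) auto
  also have "\<dots> \<le> (\<Prod>k\<in>{1..m}. exp (s\<^sup>2 * v / 4))"
  proof (intro prod_mono conjI)
    fix k assume "k \<in> {1..m}"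
    then show "expectation (h k) \<le> exp (s\<^sup>2 * v / 4)"
      unfolding h_def using mgf_pair(2)[OF in_I neq s] by blast
  qed (simp add: h_def)
  also have "\<dots> = exp (real m * s\<^sup>2 * v / 4)"
    by (simp flip: exp_of_nat_mult add: mult.assoc)
  finally show "expectation (\<lambda>\<omega>. exp (s * W \<omega>)) \<le> exp (real m * s\<^sup>2 * v / 4)" .
qed

text \<open>The means for different permutations are dependent, but after Jensen's inequality with
  weights \<open>1 / fact n\<close> only the linearity of expectation is used. Taking
  \<open>s = l / m\<close> in \<open>mgf_disjoint_pairs\<close> gives
  \<open>m * (l / m)\<^sup>2 * v / 4\<close>, the stated exponent.\<close>

lemma mgf_sample_var:
  assumes m: "m = n div 2" and l: "0 \<le> l"
  shows "integrable M (\<lambda>\<omega>. exp (l * (v - sample_var n (\<lambda>y. y) (\<lambda>i. Y i \<omega>))))"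
    "expectation (\<lambda>\<omega>. exp (l * (v - sample_var n (\<lambda>y. y) (\<lambda>i. Y i \<omega>)))) \<le> exp (l\<^sup>2 * v / (4 * real m))"
proof -
  let ?V = "\<lambda>\<omega>. sample_var n (\<lambda>y. y) (\<lambda>i. Y i \<omega>)"
  define P where "P = {\<pi>. \<pi> permutes {1..n}}"
  define W where "W = (\<lambda>\<pi> \<omega>. \<Sum>k\<in>{1..m}. v - (Y (\<pi> k) \<omega> - Y (\<pi> (k + m)) \<omega>)\<^sup>2 / 2)"
  have m0: "real m > 0" using m n_ge_2 by simp
  have fin: "finite P" and card: "card P = fact n"
    by (simp_all add: P_def finite_permutations card_permutations)
  have P: "P \<noteq> {}"
    using card by (metis card.empty fact_nonzero)
  have W: "l / m * W \<pi> \<omega>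
    = l * (v - 1 / m * (\<Sum>k\<in>{1..m}. (Y (\<pi> k) \<omega> - Y (\<pi> (k + m)) \<omega>)\<^sup>2 / 2))" for \<pi> \<omega>
    unfolding W_def sum_subtractf using m0 by (simp add: field_simps)
  have "l * (v - ?V \<omega>) = (\<Sum>\<pi>\<in>P. 1 / fact n * (l / m * W \<pi> \<omega>))" for \<omega>
  proof -
    have "(\<Sum>\<pi>\<in>P. 1 / fact n * (l / m * W \<pi> \<omega>))
      = (\<Sum>\<pi>\<in>P. 1 / fact n * l * v) - l * ?V \<omega>"
      unfolding W sample_var_eq_permutation_average[OF n_ge_2 m] P_def[symmetric]
      unfolding sum_distrib_left[of l] sum_subtractf[symmetric]
      by (intro sum.cong refl) (simp add: algebra_simps)
    then show ?thesis
      by (simp add: card algebra_simps)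
  qed
  then have jensen: "exp (l * (v - ?V \<omega>)) \<le> (\<Sum>\<pi>\<in>P. 1 / fact n * exp (l / m * W \<pi> \<omega>))" for \<omega>
    using convex_on_sum[OF fin P exp_convex, of "\<lambda>_. 1 / fact n" "\<lambda>\<pi>. l / m * W \<pi> \<omega>"]
    by (simp add: card)
  have int: "integrable M (\<lambda>\<omega>. \<Sum>\<pi>\<in>P. 1 / fact n * exp (l / m * W \<pi> \<omega>))"
    using mgf_disjoint_pairs(1)[OF m, of _ "l / m"] l m0
    unfolding W_def P_def by (intro Bochner_Integration.integrable_sum integrable_mult_right) auto
  show int': "integrable M (\<lambda>\<omega>. exp (l * (v - ?V \<omega>)))"
    by (rule Bochner_Integration.integrable_bound[OF int])
      (use jensen in \<open>auto intro!: AE_I2 intro: order_trans[OF _ abs_ge_self]\<close>)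
  have "expectation (\<lambda>\<omega>. exp (l * (v - ?V \<omega>)))
      \<le> expectation (\<lambda>\<omega>. \<Sum>\<pi>\<in>P. 1 / fact n * exp (l / m * W \<pi> \<omega>))"
    by (intro integral_mono int int' jensen)
  also have "\<dots> = (\<Sum>\<pi>\<in>P. 1 / fact n * expectation (\<lambda>\<omega>. exp (l / m * W \<pi> \<omega>)))"
    using mgf_disjoint_pairs(1)[OF m, of _ "l / m"] l m0
    unfolding W_def P_def by (subst Bochner_Integration.integral_sum) auto
  also have "\<dots> \<le> (\<Sum>\<pi>\<in>P. 1 / fact n * exp (real m * (l / m)\<^sup>2 * v / 4))"
    using mgf_disjoint_pairs(2)[OF m, of _ "l / m"] l m0
    unfolding W_def P_def by (intro sum_mono mult_left_mono) auto
  also have "\<dots> = exp (l\<^sup>2 * v / (4 * real m))"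
    using m0 by (simp add: card power2_eq_square field_simps)
  finally show "expectation (\<lambda>\<omega>. exp (l * (v - ?V \<omega>))) \<le> exp (l\<^sup>2 * v / (4 * real m))" .
qed

lemma sample_var_lower_tail:
  assumes L: "0 < L"
  shows "prob {\<omega> \<in> space M. sqrt v > sqrt (sample_var n (\<lambda>y. y) (\<lambda>i. Y i \<omega>)) + sqrt (2 * L / (real n - 1))}
    \<le> exp (- L)"
proof (cases "v = 0")
  \<comment> \<open>The choice of \<open>l\<close> in the other case divides by \<open>v\<close>;
    here the event is empty, as its right-hand side is nonnegative.\<close>
  case True
  have "sqrt (sample_var n (\<lambda>y. y) y) + sqrt (2 * L / (real n - 1)) \<ge> 0" for y
    using L n_ge_2 sample_var_nonneg[OF n_ge_2]
    by (intro add_nonneg_nonneg real_sqrt_ge_zero) auto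
  with True show ?thesis by (simp add: not_less[symmetric])
next
  case False
  then have v: "v > 0" using v_nonneg by simp
  define m where "m = n div 2"
  define c where "c = sqrt (2 * L / (real n - 1))"
  define t where "t = c * sqrt v"
  let ?V = "\<lambda>\<omega>. sample_var n (\<lambda>y. y) (\<lambda>i. Y i \<omega>)"
  have "n \<le> 2 * m + 1" unfolding m_def by simp
  then have m: "real n - 1 \<le> 2 * real m" "real m > 0"
    using n_ge_2 by (auto simp: m_def)
  have c: "c > 0" "c\<^sup>2 = 2 * L / (real n - 1)" using L n_ge_2 by (auto simp: c_def)
  \<comment> \<open>This minimises \<open>l\<^sup>2 * v / (4 * m) - l * t\<close>; the minimum is
    \<open>- m * t\<^sup>2 / v = - m * c\<^sup>2\<close>.\<close>
  define l where "l = 2 * m * t / v"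
  have l: "l > 0" using m v c by (simp add: l_def t_def)
  have "{\<omega> \<in> space M. sqrt v > sqrt (?V \<omega>) + c} \<subseteq> {\<omega> \<in> space M. v - ?V \<omega> \<ge> t}"
  proof safe
    fix \<omega> assume *: "sqrt v > sqrt (?V \<omega>) + c"
    have V: "?V \<omega> \<ge> 0" by (rule sample_var_nonneg[OF n_ge_2])
    then have "sqrt (?V \<omega>) \<ge> 0" by simp
    have "?V \<omega> = sqrt (?V \<omega>) * sqrt (?V \<omega>)"
      using V by simp
    \<comment> \<open>Only one factor is bounded by \<open>sqrt v - c\<close>, the other just by
      \<open>sqrt v\<close>; this makes the deviation \<open>c * sqrt v\<close>, whose square is
      proportional to \<open>v\<close>.\<close>
    also have "\<dots> \<le> (sqrt v - c) * sqrt v"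
      using * c(1) \<open>sqrt (?V \<omega>) \<ge> 0\<close> by (intro mult_mono) linarith+
    also have "\<dots> = v - t"
      using v by (simp add: t_def algebra_simps)
    finally show "v - ?V \<omega> \<ge> t" by simp
  qed
  then have "prob {\<omega> \<in> space M. sqrt v > sqrt (?V \<omega>) + c} \<le> prob {\<omega> \<in> space M. v - ?V \<omega> \<ge> t}"
    by (intro finite_measure_mono) auto
  also have "\<dots> \<le> exp (l\<^sup>2 * v / (4 * real m) - l * t)"
    using mgf_sample_var[OF m_def, of l] l by (intro chernoff_bound) auto
  also have "l\<^sup>2 * v / (4 * real m) - l * t = - (m * c\<^sup>2)"
    using v m by (simp add: l_def t_def power2_eq_square field_simps)
  also have "exp (- (m * c\<^sup>2)) \<le> exp (- L)"
  proof -
    \<comment> \<open>Since \<open>m * c\<^sup>2 = 2 * m * L / (n - 1)\<close>, the bound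
      \<open>n - 1 \<le> 2 * m\<close> yields \<open>m * c\<^sup>2 \<ge> L\<close>.\<close>
    have "L * (real n - 1) \<le> L * (2 * real m)"
      using m L by (intro mult_left_mono) auto
    then show ?thesis
      using n_ge_2 unfolding c by (simp add: pos_le_divide_eq mult_ac)
  qed
  finally show ?thesis unfolding c_def .
qed

section \<open>The empirical bound for a single function\<close>

lemma sets_empirical_bernstein:
  "{\<omega> \<in> space M. p - emp_mean n (\<lambda>y. y) (\<lambda>i. Y i \<omega>)
      > sqrt (2 * sample_var n (\<lambda>y. y) (\<lambda>i. Y i \<omega>) * L / n) + 7 * L / (3 * (real n - 1))} \<in> events"
  by measurable

text \<open>Outside \<open>?A\<close> and \<open>?B\<close>, the bound on \<open>sqrt v\<close> is
  inserted into \<open>sqrt (2 * v * L / n) = sqrt v * sqrt (2 * L / n)\<close>. Each of the two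
  exceptional events costs \<open>exp (- L)\<close>.\<close>

lemma empirical_bernstein:
  assumes L: "0 < L"
  shows "prob {\<omega> \<in> space M. p - emp_mean n (\<lambda>y. y) (\<lambda>i. Y i \<omega>)
      > sqrt (2 * sample_var n (\<lambda>y. y) (\<lambda>i. Y i \<omega>) * L / n) + 7 * L / (3 * (real n - 1))}
    \<le> 2 * exp (- L)"
proof -
  let ?V = "\<lambda>\<omega>. sample_var n (\<lambda>y. y) (\<lambda>i. Y i \<omega>)"
  let ?D = "\<lambda>\<omega>. p - emp_mean n (\<lambda>y. y) (\<lambda>i. Y i \<omega>)"
  let ?A = "{\<omega> \<in> space M. ?D \<omega> \<ge> sqrt (2 * v * L / n) + L / (3 * n)}"
  let ?B = "{\<omega> \<in> space M. sqrt v > sqrt (?V \<omega>) + sqrt (2 * L / (real n - 1))}"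
  have n: "real n - 1 > 0" using n_ge_2 by simp
  have "?D \<omega> \<le> sqrt (2 * ?V \<omega> * L / n) + 7 * L / (3 * (real n - 1))"
    if "?D \<omega> < sqrt (2 * v * L / n) + L / (3 * n)"
      "sqrt v \<le> sqrt (?V \<omega>) + sqrt (2 * L / (real n - 1))" for \<omega>
  proof -
    have "sqrt (2 * v * L / n) = sqrt v * sqrt (2 * L / n)"
      by (simp flip: real_sqrt_mult add: mult_ac)
    also have "\<dots> \<le> (sqrt (?V \<omega>) + sqrt (2 * L / (real n - 1))) * sqrt (2 * L / n)"
      using that L by (intro mult_right_mono) auto
    also have "\<dots> = sqrt (?V \<omega>) * sqrt (2 * L / n) + sqrt (2 * L / (real n - 1)) * sqrt (2 * L / n)"
      by (rule distrib_right)
    also have "sqrt (?V \<omega>) * sqrt (2 * L / n) = sqrt (2 * ?V \<omega> * L / n)"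
      by (simp flip: real_sqrt_mult add: mult_ac)
    \<comment> \<open>Weakening \<open>n\<close> to \<open>n - 1\<close> turns the product of roots
      into \<open>2 * L / (n - 1)\<close>; with the Bernstein term \<open>L / (3 * (n - 1))\<close>
      this gives the constant \<open>2 + 1 / 3 = 7 / 3\<close>.\<close>
    also have "sqrt (2 * L / (real n - 1)) * sqrt (2 * L / n)
        \<le> sqrt (2 * L / (real n - 1)) * sqrt (2 * L / (real n - 1))"
      using L n by (intro mult_left_mono real_sqrt_le_mono divide_left_mono) auto
    also have "\<dots> = 2 * L / (real n - 1)"
      using L n by simp
    finally have "?D \<omega> \<le> sqrt (2 * ?V \<omega> * L / n) + (2 * L / (real n - 1) + L / (3 * n))"
      using that(1) by simp
    also have "L / (3 * n) \<le> L / (3 * (real n - 1))"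
      using L n by (intro divide_left_mono) auto
    also have "2 * L / (real n - 1) + L / (3 * (real n - 1)) = 7 * L / (3 * (real n - 1))"
      using n by (simp add: divide_simps)
    finally show ?thesis by simp
  qed
  then have "{\<omega> \<in> space M. ?D \<omega> > sqrt (2 * ?V \<omega> * L / n) + 7 * L / (3 * (real n - 1))} \<subseteq> ?A \<union> ?B"
    by (fastforce simp: not_le not_less)
  then have "prob {\<omega> \<in> space M. ?D \<omega> > sqrt (2 * ?V \<omega> * L / n) + 7 * L / (3 * (real n - 1))}
      \<le> prob (?A \<union> ?B)"
    by (intro finite_measure_mono) auto
  also have "\<dots> \<le> prob ?A + prob ?B"
    by (intro measure_Un_le) auto
  also have "\<dots> \<le> exp (- L) + exp (- L)"
    by (intro add_mono bernstein sample_var_lower_tail L)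
  finally show ?thesis by simp
qed

end

section \<open>Union bound over the class of hypotheses\<close>

theorem corollary5:
  fixes \<Omega> :: "'w measure" and \<mu> :: "'a measure"
    and X :: "nat \<Rightarrow> 'w \<Rightarrow> 'a" and F :: "('a \<Rightarrow> real) set"
    and \<delta> :: real and n :: nat
  assumes "prob_space \<mu>" and "prob_space \<Omega>"
    and "finite F"
    and "\<And>f. f \<in> F \<Longrightarrow> f \<in> borel_measurable \<mu>"
    and "\<And>f x. f \<in> F \<Longrightarrow> x \<in> space \<mu> \<Longrightarrow> f x \<in> {0..1}"
    and "\<delta> > 0" and "n \<ge> 2"
    and "iid_sample \<Omega> \<mu> n X"
  shows "measure \<Omega> {\<omega> \<in> space \<Omega>. \<forall>f\<in>F.
           pop_mean f \<mu> - emp_mean n f (\<lambda>i. X i \<omega>)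
             \<le> sqrt (2 * sample_var n f (\<lambda>i. X i \<omega>) * ln (2 * real (card F) / \<delta>) / real n)
               + 7 * ln (2 * real (card F) / \<delta>) / (3 * (real n - 1))} \<ge> 1 - \<delta>"
proof -
  interpret \<Omega>: prob_space \<Omega> by fact
  let ?L = "ln (2 * real (card F) / \<delta>)"
  let ?ok = "\<lambda>f \<omega>. pop_mean f \<mu> - emp_mean n f (\<lambda>i. X i \<omega>)
    \<le> sqrt (2 * sample_var n f (\<lambda>i. X i \<omega>) * ?L / real n) + 7 * ?L / (3 * (real n - 1))"
  define bad where "bad = (\<lambda>f. {\<omega> \<in> space \<Omega>. \<not> ?ok f \<omega>})"
  \<comment> \<open>In the first two cases the claim is trivial:
    \<open>1 - \<delta> \<le> 0\<close>, or the condition over \<open>F\<close> is vacuous whatever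
    the value of \<open>ln 0\<close>. In the third, \<open>2 * card F / \<delta> > 1\<close> makes
    \<open>?L\<close> positive.\<close>
  consider "\<delta> \<ge> 1" | "F = {}" | "\<delta> < 1" "F \<noteq> {}" by fastforce
  then show ?thesis
  proof cases
    case 1
    then show ?thesis by (intro order_trans[OF _ measure_nonneg]) simp
  next
    case 2
    then show ?thesis using \<open>\<delta> > 0\<close> by (simp add: \<Omega>.prob_space)
  next
    case 3
    have card: "real (card F) \<ge> 1"
      using 3 \<open>finite F\<close> by (simp add: Suc_le_eq card_gt_0_iff)
    have L: "?L > 0"
      using 3 card \<open>\<delta> > 0\<close> by (intro ln_gt_zero) (simp add: field_simps)
    have ind: "\<Omega>.indep_vars (\<lambda>_. \<mu>) X {1..n}" and dist: "\<And>i. i \<in> {1..n} \<Longrightarrow> distr \<Omega> \<mu> (X i) = \<mu>"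
      using \<open>iid_sample \<Omega> \<mu> n X\<close> by (auto simp: iid_sample_def)
    have X [measurable]: "X i \<in> measurable \<Omega> \<mu>" if "i \<in> {1..n}" for i
      using ind that by (auto simp: \<Omega>.indep_vars_def)
    have bad_sets: "bad f \<in> sets \<Omega>" and bad_le: "measure \<Omega> (bad f) \<le> \<delta> / card F" if f: "f \<in> F" for f
    proof -
      have [measurable]: "f \<in> borel_measurable \<mu>"
        by (rule assms(4)[OF f])
      have transfer: "\<Omega>.expectation (\<lambda>\<omega>. g (X i \<omega>)) = (\<integral>x. g x \<partial>\<mu>)"
        if "i \<in> {1..n}" "g \<in> borel_measurable \<mu>" for g :: "'a \<Rightarrow> real" and i
        using integral_distr[OF X[OF that(1)] that(2)] dist[OF that(1)] by simp
      interpret iid_unit_interval \<Omega> n "\<lambda>i \<omega>. f (X i \<omega>)" "pop_mean f \<mu>"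
        "\<integral>x. (f x - pop_mean f \<mu>)\<^sup>2 \<partial>\<mu>"
      proof unfold_locales
        show "\<Omega>.indep_vars (\<lambda>_. borel) (\<lambda>i \<omega>. f (X i \<omega>)) {1..n}"
          by (rule \<Omega>.indep_vars_compose2[OF ind]) simp
        show "f (X i \<omega>) \<in> {0..1}" if "i \<in> {1..n}" "\<omega> \<in> space \<Omega>" for i \<omega>
          using assms(5)[OF f] measurable_space[OF X[OF that(1)] that(2)] by blast
        show "\<Omega>.expectation (\<lambda>\<omega>. f (X i \<omega>)) = pop_mean f \<mu>" if "i \<in> {1..n}" for i
          using transfer[OF that, of f] by (simp add: pop_mean_def)
        show "\<Omega>.expectation (\<lambda>\<omega>. (f (X i \<omega>) - pop_mean f \<mu>)\<^sup>2) = (\<integral>x. (f x - pop_mean f \<mu>)\<^sup>2 \<partial>\<mu>)"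
          if "i \<in> {1..n}" for i
          by (intro transfer that) measurable
      qed (fact \<open>n \<ge> 2\<close>)
      \<comment> \<open>Both statistics depend on \<open>f\<close> and the sample only through the
        values \<open>f (x i)\<close>, so the results on \<open>Y\<close> carry over.\<close>
      have eq: "emp_mean n f x = emp_mean n (\<lambda>y. y) (\<lambda>i. f (x i))"
        "sample_var n f x = sample_var n (\<lambda>y. y) (\<lambda>i. f (x i))" for x
        by (simp_all add: emp_mean_def sample_var_def)
      show "bad f \<in> sets \<Omega>"
        using sets_empirical_bernstein[of ?L] unfolding bad_def eq not_le .
      have "measure \<Omega> (bad f) \<le> 2 * exp (- ?L)"
        using empirical_bernstein[OF L] unfolding bad_def eq not_le .
      \<comment> \<open>The factor \<open>2\<close> inside the logarithm pays for the two
        exceptional events of each \<open>f\<close>.\<close>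
      also have "\<dots> = \<delta> / card F"
        unfolding exp_minus using card \<open>\<delta> > 0\<close> by (subst exp_ln) auto
      finally show "measure \<Omega> (bad f) \<le> \<delta> / card F" .
    qed
    have "measure \<Omega> (\<Union>f\<in>F. bad f) \<le> (\<Sum>f\<in>F. measure \<Omega> (bad f))"
      using bad_sets \<open>finite F\<close> by (intro \<Omega>.finite_measure_subadditive_finite) auto
    also have "\<dots> \<le> (\<Sum>f\<in>F. \<delta> / card F)"
      by (intro sum_mono bad_le)
    also have "\<dots> = \<delta>"
      using card by simp
    finally have "1 - \<delta> \<le> 1 - measure \<Omega> (\<Union>f\<in>F. bad f)" by simp
    also have "\<dots> = measure \<Omega> (space \<Omega> - (\<Union>f\<in>F. bad f))"
      using bad_sets \<open>finite F\<close> by (intro \<Omega>.prob_compl[symmetric] sets.finite_UN) auto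
    also have "space \<Omega> - (\<Union>f\<in>F. bad f) = {\<omega> \<in> space \<Omega>. \<forall>f\<in>F. ?ok f \<omega>}"
      by (auto simp: bad_def)
    finally show ?thesis .
  qed
qed

end
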